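(* Let $n$ be an odd positive integer, let $p$ be the least prime divisor of $n$, and let $r \geq 2$ be an integer. Define \[ \beta(n,r) = (-1)^{\lfloor r/2 \rfloor} \binom{\frac{n-1}{2} - \lceil r/2 \rceil}{\lfloor r/2 \rfloor} - \binom{\frac{n-1}{2}}{r} (-2)^r , \] and let $\alpha(n,r)$ be the non-negative residue of $\beta(n,r)$ modulo $n$. Then $\alpha(n,r) \equiv 0 \pmod{n}$ if $r < p$, and $\alpha(n,r) \equiv n/p \pmod{n}$ if $r = p$.
   Context: $\lfloor a \rfloor$ denotes the greatest integer $\le a$ and $\lceil a \rceil$ the least integer $\ge a$. Binomial coefficients $\binom{m}{k}$ with integers $m, k \ge 0$ are the usual ones (equal to $0$ when $k > m$). The non-negative residue of an integer $b$ modulo $n$ is the unique integer $a$ with $0 \le a < n$ and $a \equiv b \pmod n$. *)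

theory Defs
  imports "HOL-Number_Theory.Number_Theory"
begin

text \<open>
  The upper entry \<open>(n - 1) / 2 - \<lceil>r / 2\<rceil>\<close> of the first binomial coefficient below can be negative
  (it is \<open>-1\<close> for \<open>n = p = r\<close>), so binomial coefficients \<open>a (a - 1) \<dots> (a - k + 1) / k!\<close>
  with an arbitrary integer upper entry are needed. A sort constraint in theory Binomial keeps
  \<^const>\<open>gbinomial\<close> from being written down at type \<^typ>\<open>int\<close>, hence \<open>int_gchoose\<close>. The floor only
  changes the type and never rounds, by \<open>of_int_int_gchoose\<close>.
\<close>

definition int_gchoose :: "int \<Rightarrow> nat \<Rightarrow> int" where
  "int_gchoose a k = \<lfloor>rat_of_int a gchoose k\<rfloor>"

lemma of_int_int_gchoose: "rat_of_int (int_gchoose a k) = rat_of_int a gchoose k"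
  by (simp add: int_gchoose_def flip: of_int_gbinomial)

lemma int_gchoose_of_nat: "int_gchoose (int m) k = int (m choose k)"
  by (simp add: int_gchoose_def flip: binomial_gbinomial)

text \<open>For odd \<open>n\<close> the division in \<open>(int n - 1) div 2\<close> is exact.\<close>

definition beta :: "nat \<Rightarrow> nat \<Rightarrow> int" where
  "beta n r =
     (-1) ^ nat \<lfloor>real r / 2\<rfloor> *
       int_gchoose ((int n - 1) div 2 - \<lceil>real r / 2\<rceil>) (nat \<lfloor>real r / 2\<rfloor>)
     - int_gchoose ((int n - 1) div 2) r * (-2) ^ r"

definition alpha :: "nat \<Rightarrow> nat \<Rightarrow> int" where
  "alpha n r = beta n r mod int n"

end

theory Submission
  imports Defs
begin

text \<open>
  Let \<open>f = \<lfloor>r / 2\<rfloor>\<close>, \<open>c = \<lceil>r / 2\<rceil>\<close> and \<open>D(k, x) = (1 - x) (3 - x) \<dots> (2 k - 1 - x)\<close>. Clearing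
  denominators in the two binomial coefficients turns them into values of \<open>D\<close>, and separating the
  odd from the even factors of \<open>r!\<close> gives
  \<open>r! \<beta>(n, r) = (D(c, 0) - D(c, n)) D(f, n - 2 c)\<close>, which is a multiple of \<open>n\<close>.
  If \<open>r < p\<close>, then \<open>r!\<close> is coprime to \<open>n\<close>. If \<open>r = p\<close>, then \<open>D(c, x) = (p - x) D(f, x)\<close>, and
  cancelling \<open>p\<close> leaves
  \<open>(p - 1)! \<beta>(n, p) = (D(f, 0) - D(f, n)) D(f, n - p - 1) + (n / p) D(f, n) D(f, n - p - 1)\<close>,
  where \<open>D(f, n) D(f, n - p - 1) \<equiv> D(f, 0) D(f, -1) = (p - 1)!\<close> modulo \<open>p\<close>.
\<close>

text \<open>This is D(k, x).\<close>

definition odd_prod :: "nat \<Rightarrow> int \<Rightarrow> int" where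
  "odd_prod k x = (\<Prod>i<k. 2 * int i + 1 - x)"

lemma odd_prod_0 [simp]: "odd_prod 0 x = 1"
  by (simp add: odd_prod_def)

lemma odd_prod_Suc: "odd_prod (Suc k) x = odd_prod k x * (2 * int k + 1 - x)"
  by (simp add: odd_prod_def)

lemma odd_prod_add: "odd_prod (a + b) x = odd_prod a x * odd_prod b (x - 2 * int a)"
  by (induction b) (simp_all add: odd_prod_Suc algebra_simps)

lemma odd_prod_cong: "[x = y] (mod m) \<Longrightarrow> [odd_prod k x = odd_prod k y] (mod m)"
  unfolding odd_prod_def by (intro cong_prod cong_diff cong_refl)

text \<open>At x = -1 the factors are the even numbers 2, 4, ..., 2 k.\<close>

lemma odd_prod_minus_1: "odd_prod k (-1) = 2 ^ k * fact k"
  by (induction k) (simp_all add: odd_prod_Suc algebra_simps)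

lemma fact_even_eq_odd_prod: "(fact (2 * k) :: int) = odd_prod k 0 * odd_prod k (-1)"
  by (induction k) (simp_all add: odd_prod_Suc algebra_simps)

lemma fact_eq_odd_prod: "(fact r :: int) = odd_prod (r - r div 2) 0 * odd_prod (r div 2) (-1)"
proof (cases "even r")
  case True
  then obtain k where "r = 2 * k" by blast
  then show ?thesis using fact_even_eq_odd_prod[of k] by simp
next
  case False
  then obtain k where r: "r = Suc (2 * k)" by (elim oddE) simp
  then have "r div 2 = k" "r - r div 2 = Suc k" by simp_all
  then show ?thesis using fact_even_eq_odd_prod[of k]
    by (simp add: r odd_prod_Suc algebra_simps)
qed

text \<open>Each factor a - i of the falling factorial, multiplied by -2, becomes 2 i + 1 - (2 a +
  1).\<close>

lemma fact_mult_int_gchoose: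
  "fact k * ((-2) ^ k * int_gchoose a k) = odd_prod k (2 * a + 1)"
proof -
  have "rat_of_int (fact k * int_gchoose a k) = rat_of_int (\<Prod>i<k. a - int i)"
    by (simp add: of_int_int_gchoose gbinomial_mult_fact atLeast0LessThan)
  then have "fact k * int_gchoose a k = (\<Prod>i<k. a - int i)"
    by (simp only: of_int_eq_iff)
  then have "fact k * ((-2) ^ k * int_gchoose a k) = (\<Prod>i<k. -2) * (\<Prod>i<k. a - int i)"
    by (simp add: algebra_simps)
  also have "\<dots> = odd_prod k (2 * a + 1)"
    unfolding odd_prod_def prod.distrib[symmetric] by (intro prod.cong) auto
  finally show ?thesis .
qed

text \<open>The second binomial yields D(r, n). Splitting it after c factors leaves the tail D(f, n
  - 2 c), which is also what the first binomial yields, so it factors out.\<close>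

lemma fact_mult_beta:
  fixes n r :: nat
  assumes "odd n"
  defines "f \<equiv> r div 2"
  defines "c \<equiv> r - f"
  shows "fact r * beta n r = (odd_prod c 0 - odd_prod c (int n)) * odd_prod f (int n - 2 * int c)"
proof -
  define N where "N = (int n - 1) div 2"
  have N: "2 * N + 1 = int n"
    using assms(1) unfolding N_def by (elim oddE) simp
  have r: "r = c + f"
    by (simp add: c_def f_def)
  have floor: "nat \<lfloor>real r / 2\<rfloor> = f"
    unfolding f_def by linarith
  have ceiling: "\<lceil>real r / 2\<rceil> = int c"
    unfolding c_def f_def by linarith
  have beta: "beta n r = (-1) ^ f * int_gchoose (N - int c) f - int_gchoose N r * (-2) ^ r"
    unfolding beta_def floor ceiling N_def ..
  \<comment> \<open>The odd part of r! stays as D(c, 0); the even part 2^f f! clears the denominator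
    of the binomial and turns the sign into (-2)^f.\<close>
  have "fact r * ((-1) ^ f * int_gchoose (N - int c) f)
      = odd_prod c 0 * (fact f * ((-1) ^ f * 2 ^ f * int_gchoose (N - int c) f))"
    unfolding fact_eq_odd_prod[of r] odd_prod_minus_1 f_def[symmetric] c_def[symmetric]
    by (simp add: algebra_simps)
  also have "(-1) ^ f * 2 ^ f = (-2 :: int) ^ f"
    by (simp flip: power_mult_distrib)
  also have "fact f * ((-2) ^ f * int_gchoose (N - int c) f) = odd_prod f (int n - 2 * int c)"
    unfolding fact_mult_int_gchoose by (simp add: algebra_simps flip: N)
  finally have first: "fact r * ((-1) ^ f * int_gchoose (N - int c) f)
      = odd_prod c 0 * odd_prod f (int n - 2 * int c)" .
  have "fact r * (int_gchoose N r * (-2) ^ r) = odd_prod r (int n)"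
    using fact_mult_int_gchoose[of r N] unfolding N by (simp only: mult.commute)
  also have "\<dots> = odd_prod c (int n) * odd_prod f (int n - 2 * int c)"
    unfolding r odd_prod_add ..
  finally show ?thesis
    using first unfolding beta by (simp add: algebra_simps)
qed

text \<open>Allows factorials to be cancelled modulo n: primes dividing k! are at most k, those
  dividing n at least p.\<close>

lemma coprime_fact_less_least_prime_divisor:
  fixes n p k :: nat
  assumes "\<And>q. prime q \<Longrightarrow> q dvd n \<Longrightarrow> p \<le> q" and "k < p"
  shows "coprime (fact k) (int n)"
proof -
  have "coprime (fact k) n"
  proof (rule ccontr)
    assume "\<not> coprime (fact k) n"
    then obtain d where "d dvd fact k" "d dvd n" "d \<noteq> 1"
      by (auto elim: not_coprimeE)
    moreover from \<open>d \<noteq> 1\<close> obtain q where "prime q" "q dvd d"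
      using prime_factor_nat by blast
    ultimately have "q dvd fact k" "q dvd n"
      by (blast intro: dvd_trans)+
    then have "q \<le> k" "p \<le> q"
      using assms(1) \<open>prime q\<close> by (simp_all add: prime_dvd_fact_iff)
    with assms(2) show False by simp
  qed
  then have "coprime (int (fact k)) (int n)"
    by (simp only: coprime_int_iff)
  then show ?thesis by simp
qed

text \<open>D(k, x) is an integer polynomial in x, and x is congruent to 0 modulo x.\<close>

lemma dvd_odd_prod_diff: "x dvd odd_prod k 0 - odd_prod k x"
  using odd_prod_cong[of 0 x x k] by (simp add: cong_iff_dvd_diff)

lemma beta_cong_0:
  fixes n p r :: nat
  assumes "odd n" and "\<And>q. prime q \<Longrightarrow> q dvd n \<Longrightarrow> p \<le> q" and "r < p"
  shows "[beta n r = 0] (mod int n)"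
proof -
  have "int n dvd fact r * beta n r"
    unfolding fact_mult_beta[OF assms(1)] by (intro dvd_mult2 dvd_odd_prod_diff)
  moreover have "coprime (int n) (fact r)"
    using coprime_fact_less_least_prime_divisor[OF assms(2,3)] by (simp add: coprime_commute)
  ultimately show ?thesis
    by (simp add: cong_0_iff coprime_dvd_mult_right_iff)
qed

lemma beta_cong_div:
  fixes n p :: nat
  assumes "odd n" and "p dvd n" and "\<And>q. prime q \<Longrightarrow> q dvd n \<Longrightarrow> p \<le> q"
  shows "[beta n p = int (n div p)] (mod int n)"
proof -
  define f where "f = p div 2"
  define A where "A = odd_prod f (int n - 2 * int (Suc f))"
  obtain m where n: "n = p * m" using assms(2) by blast
  have "odd p" using assms(1,2) by (metis dvd_trans)
  then have p: "p = Suc (2 * f)" by (simp add: f_def)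
  have "p > 0" using p by simp
  have fact: "fact (2 * f) = odd_prod f 0 * odd_prod f (-1)"
    by (rule fact_even_eq_odd_prod)
  have c: "p - p div 2 = Suc f"
    using p by (simp add: f_def)
  have "int p * (fact (2 * f) * beta n p) = fact p * beta n p"
    using p by simp
  also have "\<dots> = (odd_prod (Suc f) 0 - odd_prod (Suc f) (int n)) * A"
    unfolding fact_mult_beta[OF assms(1)] c A_def f_def ..
  \<comment> \<open>The last factor 2 f + 1 - x of D(f + 1, x) is p at x = 0 and p (1 - m) at x =
    n.\<close>
  also have "\<dots> = int p * ((odd_prod f 0 - odd_prod f (int n)) * A + int m * (odd_prod f (int n) * A))"
    using p by (simp add: odd_prod_Suc n algebra_simps)
  finally have eq: "fact (2 * f) * beta n p
      = (odd_prod f 0 - odd_prod f (int n)) * A + int m * (odd_prod f (int n) * A)"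
    using \<open>p > 0\<close> by simp
  have "[int n = 0] (mod int p)"
    by (simp add: n cong_0_iff)
  moreover have "[int n - 2 * int (Suc f) = -1] (mod int p)"
  proof -
    have "int n - 2 * int (Suc f) - (-1) = int p * (int m - 1)"
      using p by (simp add: n algebra_simps)
    then show ?thesis by (simp add: cong_iff_dvd_diff)
  qed
  ultimately have "[odd_prod f (int n) * A = fact (2 * f)] (mod int p)"
    unfolding A_def fact by (intro cong_mult odd_prod_cong)
  \<comment> \<open>Multiplication by m = n / p lifts the congruence from modulus p to modulus
    n.\<close>
  then have "int m * int p dvd int m * (odd_prod f (int n) * A - fact (2 * f))"
    by (intro mult_dvd_mono dvd_refl) (simp add: cong_iff_dvd_diff)
  then have "[int m * (odd_prod f (int n) * A) = int m * fact (2 * f)] (mod int n)"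
    by (simp add: n cong_iff_dvd_diff right_diff_distrib mult.commute)
  moreover have "[(odd_prod f 0 - odd_prod f (int n)) * A = 0] (mod int n)"
    unfolding cong_0_iff by (intro dvd_mult2 dvd_odd_prod_diff)
  ultimately have "[fact (2 * f) * beta n p = 0 + int m * fact (2 * f)] (mod int n)"
    unfolding eq by (intro cong_add)
  then have "[fact (2 * f) * beta n p = fact (2 * f) * int m] (mod int n)"
    by (simp add: mult.commute)
  moreover have "coprime (fact (2 * f)) (int n)"
    using coprime_fact_less_least_prime_divisor[OF assms(3)] p by simp
  ultimately have "[beta n p = int m] (mod int n)"
    by (simp add: cong_mult_lcancel)
  then show ?thesis
    using \<open>p > 0\<close> by (simp add: n)
qed

theorem theorem1p1:
  fixes n p r :: nat
  assumes "odd n"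
    and "prime p" and "p dvd n" and "\<And>q. prime q \<Longrightarrow> q dvd n \<Longrightarrow> p \<le> q"
    and "r \<ge> 2"
  shows "(r < p \<longrightarrow> [alpha n r = 0] (mod int n)) \<and>
         (r = p \<longrightarrow> [alpha n r = int (n div p)] (mod int n))"
proof -
  have "[alpha n r = beta n r] (mod int n)"
    by (simp add: alpha_def)
  then show ?thesis
    using beta_cong_0[OF assms(1,4)] beta_cong_div[OF assms(1,3,4)] by (metis cong_trans)
qed

end
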